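(* Fix $k,N,M\in\mathbb{N}$ with $N\le M$, and write $G_{k,N,M}(x)=\sum_{n\ge0}c_{k,N,M}(n)x^n$. Define $$\Delta_{k,N,M}:=(k+1)N(M-1)+N-M$$ and $$\Lambda_{k,N,M}:=\operatorname{lcm}\Bigl(\{(k+1)j+1:0\le j<M\}\cup\{2(k+1)i-2:1\le i\le N\}\Bigr).$$ There exist polynomials $Q_0(X),Q_1(X),\ldots,Q_{\Lambda_{k,N,M}-1}(X)\in\mathbb{Q}[X]$ of degree at most $M-1$ such that $c_{k,N,M}(n)=Q_r(n)$ whenever $n>\Delta_{k,N,M}$ and $n\equiv r\pmod{\Lambda_{k,N,M}}$. Moreover: (i) If $M>N$, every $Q_r$ has leading coefficient $$\frac{2^{M-1}}{(M-1)!\prod_{j=0}^{M-1}((k+1)j+1)}.$$ (ii) If $M=N\ge2$ and $k$ is even, every $Q_r$ has leading coefficient $$\frac{2^{N-1}}{(N-1)!\prod_{j=0}^{N-1}((k+1)j+1)}.$$ (iii) If $M=N\ge2$ and $k>1$ is odd, the leading coefficient in parity class $r$ (that is, of $Q_r$, depending only on the parity of $r$) is $$\frac{1}{(N-1)!}\left(\frac{2^{N-1}}{\prod_{j=0}^{N-1}((k+1)j+1)}+(-1)^r\frac{2^{N-1}}{\prod_{i=1}^{N}((k+1)i-1)}\right),$$ and this number is positive for both parities. Consequently, every fixed finite product $G_{k,N,M}(x)$ (with $k,N,M\in\mathbb{N}$, $N\le M$) is eventually strictly positive, i.e. $c_{k,N,M}(n)>0$ for all sufficiently large $n$, except that when $M=N$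 and $k=1$, every odd-degree coefficient is zero and every even-degree coefficient is positive.
   Context: $\mathbb{N}$ is the set of positive integers. Notation: $(z;q)_n=\prod_{i=0}^{n-1}(1-zq^i)$. For $k,N,M\in\mathbb{N}$, $$G_{k,N,M}(x):=\frac{(-x^{k+1};x^{k+1})_{N+M-1}}{(-x^{k};x^{k+1})_N\,(x;x^{k+1})_M}=\frac{\prod_{r=1}^{N+M-1}(1+x^{(k+1)r})}{\prod_{i=1}^{N}(1+x^{(k+1)i-1})\prod_{j=0}^{M-1}(1-x^{(k+1)j+1})},$$ expanded as a formal power series in $x$.
   Formalization: Eventual strict positivity is not claimed for M=N=1 with k≥2, where it is false: G_{k,1,1}=1/(1-x)-x^k/(1+x^k), so the coefficient of x^{km} is 0 for every odd m. *)

theory Defs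
  imports Complex_Main "HOL-Computational_Algebra.Computational_Algebra"
    "HOL-Number_Theory.Cong"
begin

text \<open>The finite $q$-Pochhammer symbol $(z;q)_n$.\<close>

definition qpoch :: "'a::comm_ring_1 \<Rightarrow> 'a \<Rightarrow> nat \<Rightarrow> 'a" where
  "qpoch z q n = (\<Prod>i<n. 1 - z * q ^ i)"

text \<open>The subtraction \<open>N + M - 1\<close> is on \<open>nat\<close>; it does not truncate for positive \<open>N\<close>, \<open>M\<close>.
  The denominator has constant term 1 if \<open>k\<close> is positive, so the quotient is the
  product with the power series inverse.\<close>

definition G :: "nat \<Rightarrow> nat \<Rightarrow> nat \<Rightarrow> rat fps" where
  "G k N M =
     qpoch (- (fps_X ^ (k + 1))) (fps_X ^ (k + 1)) (N + M - 1) /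
     (qpoch (- (fps_X ^ k)) (fps_X ^ (k + 1)) N * qpoch fps_X (fps_X ^ (k + 1)) M)"

definition c :: "nat \<Rightarrow> nat \<Rightarrow> nat \<Rightarrow> nat \<Rightarrow> rat" where
  "c k N M n = fps_nth (G k N M) n"

definition Delta :: "nat \<Rightarrow> nat \<Rightarrow> nat \<Rightarrow> int" where
  "Delta k N M = (int k + 1) * int N * (int M - 1) + int N - int M"

text \<open>The \<open>nat\<close> subtraction in \<open>2 * (k + 1) * i - 2\<close> does not truncate since
  \<open>i\<close> is positive.\<close>

definition Lam :: "nat \<Rightarrow> nat \<Rightarrow> nat \<Rightarrow> nat" where
  "Lam k N M =
     Lcm ({(k + 1) * j + 1 | j. j < M} \<union> {2 * (k + 1) * i - 2 | i. 1 \<le> i \<and> i \<le> N})"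

lemma G_expanded:
  "G k N M =
     (\<Prod>r=1..N + M - 1. 1 + fps_X ^ ((k + 1) * r)) /
     ((\<Prod>i=1..N. 1 + fps_X ^ ((k + 1) * i - 1)) * (\<Prod>j<M. 1 - fps_X ^ ((k + 1) * j + 1)))"
proof -
  have 1: "qpoch (- (fps_X ^ (k + 1))) (fps_X ^ (k + 1)) n
      = (\<Prod>r=1..n. 1 + fps_X ^ ((k + 1) * r) :: rat fps)" for n
  proof -
    have "qpoch (- (fps_X ^ (k + 1))) (fps_X ^ (k + 1)) n
        = (\<Prod>i<n. 1 + ((fps_X :: rat fps) ^ (k + 1)) ^ Suc i)"
      unfolding qpoch_def by (simp only: power_Suc) simp
    also have "\<dots> = (\<Prod>i<n. 1 + fps_X ^ ((k + 1) * Suc i))"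
      by (simp only: power_mult)
    also have "\<dots> = (\<Prod>r=1..n. 1 + fps_X ^ ((k + 1) * r))"
      by (rule prod.reindex_bij_witness[where i = "\<lambda>r. r - 1" and j = Suc]) auto
    finally show ?thesis .
  qed
  have 2: "qpoch (- (fps_X ^ k)) (fps_X ^ (k + 1)) n
      = (\<Prod>i=1..n. 1 + fps_X ^ ((k + 1) * i - 1) :: rat fps)" for n
  proof -
    have eq: "1 - (- (fps_X ^ k)) * (fps_X ^ (k + 1)) ^ i
        = 1 + (fps_X :: rat fps) ^ ((k + 1) * Suc i - 1)" for i
    proof -
      have "(k + 1) * Suc i - 1 = k + (k + 1) * i" by simp
      then show ?thesis by (simp only: power_add power_mult) simp
    qed
    show ?thesis
      unfolding qpoch_def eq
      by (rule prod.reindex_bij_witness[where i = "\<lambda>r. r - 1" and j = Suc]) auto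
  qed
  have 3: "qpoch fps_X (fps_X ^ (k + 1)) n
      = (\<Prod>j<n. 1 - fps_X ^ ((k + 1) * j + 1) :: rat fps)" for n
    unfolding qpoch_def
  proof (intro prod.cong refl)
    fix j
    have "fps_X * (fps_X ^ (k + 1)) ^ j = (fps_X :: rat fps) ^ ((k + 1) * j + 1)"
      by (metis power_mult power_Suc Suc_eq_plus1)
    then show "1 - fps_X * (fps_X ^ (k + 1)) ^ j = 1 - (fps_X :: rat fps) ^ ((k + 1) * j + 1)"
      by simp
  qed
  show ?thesis unfolding G_def 1 2 3 ..
qed

text \<open>For \<open>M = N = 1\<close> eventual positivity fails for every \<open>k\<close>, not only for \<open>k = 1\<close>:
  $G_{k,1,1}(x) = (1 + x^{k+1}) / ((1 + x^k)(1 - x)) = 1/(1-x) - x^k/(1 + x^k)$, so the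
  coefficients of $x^{km}$ with odd $m$ vanish. Statements of eventual positivity must
  therefore exclude this case.\<close>

lemma c_k_1_1_eq_0:
  assumes k: "k \<ge> 1" and m: "odd m"
  shows "c k 1 1 (k * m) = 0"
proof -
  define A :: "rat fps" where "A = Abs_fps (\<lambda>n. if k dvd n then (- 1) ^ (n div k) else 0)"
  define B :: "rat fps" where "B = Abs_fps (\<lambda>_. 1)"
  have A: "A * (1 + fps_X ^ k) = 1"
  proof (rule fps_ext)
    fix n
    have eq: "A * (1 + fps_X ^ k) = A + fps_X ^ k * A" by (simp add: algebra_simps)
    consider "n = 0" | "0 < n" "n < k" | "k \<le> n" by linarith
    then show "fps_nth (A * (1 + fps_X ^ k)) n = fps_nth 1 n"
    proof cases
      case 3
      then obtain t where n: "n = k + t" using le_Suc_ex by blast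
      show ?thesis unfolding eq n using k
        by (auto simp: A_def fps_X_power_mult_nth)
    qed (unfold eq, use k in \<open>auto simp: A_def fps_X_power_mult_nth dest: dvd_imp_le\<close>)
  qed
  have B: "B * (1 - fps_X) = 1"
  proof (rule fps_ext)
    fix n
    have eq: "B * (1 - fps_X) = B - fps_X * B" by (simp add: algebra_simps)
    show "fps_nth (B * (1 - fps_X)) n = fps_nth 1 n"
      unfolding eq by (cases n) (auto simp: B_def)
  qed
  define D :: "rat fps" where "D = (1 + fps_X ^ k) * (1 - fps_X)"
  have "(B - fps_X ^ k * A) * D
      = (B * (1 - fps_X)) * (1 + fps_X ^ k) - fps_X ^ k * (A * (1 + fps_X ^ k)) * (1 - fps_X)"
    by (simp add: D_def algebra_simps)
  also have "\<dots> = 1 + fps_X ^ (k + 1)" by (simp only: A B) (simp add: algebra_simps)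
  finally have num: "1 + fps_X ^ (k + 1) = (B - fps_X ^ k * A) * D" by simp
  have "D \<noteq> 0" using A B by (metis D_def mult_zero_right mult.commute mult.left_commute mult_1_left zero_neq_one)
  have "G k 1 1 = (1 + fps_X ^ (k + 1)) / D"
    by (simp add: G_def qpoch_def D_def)
  also have "\<dots> = B - fps_X ^ k * A"
    unfolding num using \<open>D \<noteq> 0\<close> by simp
  finally have G: "G k 1 1 = B - fps_X ^ k * A" .
  obtain l where l: "m = Suc (2 * l)" using m by (auto elim!: oddE)
  have le: "k \<le> k * m" and diff: "k * m - k = k * (2 * l)" using l by auto
  show ?thesis
    unfolding c_def G using k le diff by (simp add: A_def B_def fps_X_power_mult_nth)
qed

corollary not_eventually_pos_1_1:
  assumes k: "k \<ge> 1"
  shows "\<not> (\<forall>\<^sub>F n in sequentially. c k 1 1 n > 0)"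
proof
  assume "\<forall>\<^sub>F n in sequentially. c k 1 1 n > 0"
  then obtain n0 where n0: "\<And>n. n \<ge> n0 \<Longrightarrow> c k 1 1 n > 0"
    by (auto simp: eventually_sequentially)
  have "1 * n0 \<le> k * (2 * n0 + 1)" using k by (intro mult_le_mono) auto
  then show False using n0[of "k * (2 * n0 + 1)"] c_k_1_1_eq_0[OF k, of "2 * n0 + 1"] by simp
qed

end

theory Submission
  imports Defs
begin

text \<open>
  Put \<open>L = Lam k N M\<close>. Every root of the denominator \<open>D\<close> of \<open>G\<close> is an \<open>L\<close>-th root of unity, and
  its order as a pole of \<open>G = P / D\<close> is at most \<open>M\<close>. Hence \<open>R = P (1 - x\<^sup>L)\<^sup>M / D\<close> is a polynomial,
  and expanding \<open>1 / (1 - x\<^sup>L)\<^sup>M\<close> expresses the coefficients of \<open>G = R / (1 - x\<^sup>L)\<^sup>M\<close> beyond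
  \<open>degree R - L M = Delta k N M\<close> by a polynomial of degree at most \<open>M - 1\<close> on each residue class
  modulo \<open>L\<close>. Its coefficient of degree \<open>M - 1\<close> is, up to a constant, the sum of the coefficients of
  \<open>R\<close> in that class. For \<open>M \<ge> 2\<close> all poles other than \<open>1\<close> (and \<open>- 1\<close>, if \<open>M = N\<close> and \<open>k\<close> is odd) have
  order less than \<open>M\<close>, so \<open>R\<close> vanishes at all other \<open>L\<close>-th roots of unity and the sum is
  \<open>(R 1 + (- 1)\<^sup>r R (- 1)) / L\<close>.

  For \<open>k = 1\<close>, \<open>M = N\<close> the denominator collapses to a product of factors \<open>1 - x\<^bsup>4j+2\<^esup>\<close>, so that \<open>G\<close> is
  \<open>1 / (1 - x\<^sup>2)\<close> times a series in \<open>x\<^sup>2\<close> with nonnegative coefficients.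
\<close>

subsection \<open>Polynomials over the rational and the complex numbers\<close>

lemma map_poly_of_rat_mult:
  "map_poly of_rat (p * q) = (map_poly of_rat p * map_poly of_rat q :: 'a::field_char_0 poly)"
  by (intro poly_eqI) (simp add: coeff_map_poly coeff_mult of_rat_sum of_rat_mult)

lemma map_poly_of_rat_add:
  "map_poly of_rat (p + q) = (map_poly of_rat p + map_poly of_rat q :: 'a::field_char_0 poly)"
  by (intro poly_eqI) (simp add: coeff_map_poly of_rat_add)

lemma map_poly_of_rat_prod:
  "map_poly of_rat (\<Prod>i\<in>A. f i) = (\<Prod>i\<in>A. map_poly of_rat (f i) :: 'a::field_char_0 poly)"
  by (induction A rule: infinite_finite_induct) (auto simp: map_poly_of_rat_mult)

lemma map_poly_of_rat_power:
  "map_poly of_rat (p ^ n) = (map_poly of_rat p ^ n :: 'a::field_char_0 poly)"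
  by (induction n) (auto simp: map_poly_of_rat_mult)

lemma degree_map_poly_of_rat:
  "degree (map_poly of_rat p :: 'a::field_char_0 poly) = degree p"
  by (rule degree_map_poly) auto

lemma map_poly_of_rat_eq_0_iff:
  "(map_poly of_rat p :: 'a::field_char_0 poly) = 0 \<longleftrightarrow> p = 0"
  by (rule map_poly_eq_0_iff) auto

lemma poly_map_poly_of_rat:
  "poly (map_poly of_rat p) (of_rat x) = (of_rat (poly p x) :: 'a::field_char_0)"
  by (simp add: poly_altdef degree_map_poly_of_rat coeff_map_poly of_rat_sum of_rat_mult of_rat_power)

text \<open>Division with remainder over the rationals stays division with remainder over the larger
  field. There \<open>p\<close> divides the remainder, whose degree is too small unless it
  vanishes.\<close>

lemma map_poly_of_rat_dvdD:
  assumes "(map_poly of_rat p :: 'a::field_char_0 poly) dvd map_poly of_rat q"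
  shows "p dvd q"
proof (cases "p = 0")
  case True
  then show ?thesis using assms by (simp add: map_poly_of_rat_eq_0_iff)
next
  case False
  have "map_poly of_rat q = (map_poly of_rat p * map_poly of_rat (q div p) + map_poly of_rat (q mod p) :: 'a poly)"
    by (simp flip: map_poly_of_rat_mult map_poly_of_rat_add)
  then have dvd: "(map_poly of_rat p :: 'a poly) dvd map_poly of_rat (q mod p)"
    using assms by (simp add: dvd_add_right_iff)
  have "q mod p = 0"
  proof (rule ccontr)
    assume "q mod p \<noteq> 0"
    then have "degree p \<le> degree (q mod p)"
      using dvd_imp_degree_le[OF dvd] by (simp add: degree_map_poly_of_rat map_poly_of_rat_eq_0_iff)
    then show False using degree_mod_less[of p q] False \<open>q mod p \<noteq> 0\<close> by auto
  qed
  then show ?thesis by auto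
qed

text \<open>Over the complex numbers a polynomial is a constant times a product of linear factors,
  so multiplicities of roots decide divisibility.\<close>

lemma complex_poly_dvdI_order:
  fixes p q :: "complex poly"
  assumes "p \<noteq> 0" "\<And>z. order z p \<le> order z q"
  shows "p dvd q"
proof (cases "q = 0")
  case False
  have "(\<Prod>z | poly p z = 0. [:-z, 1:] ^ order z p) dvd (\<Prod>z | poly q z = 0. [:-z, 1:] ^ order z q)"
  proof (rule prod_dvd_prod_subset2)
    show "{z. poly p z = 0} \<subseteq> {z. poly q z = 0}"
      using assms False by (metis (mono_tags, lifting) Collect_mono le_zero_eq order_root)
  qed (use assms False in \<open>auto intro: poly_roots_finite le_imp_power_dvd\<close>)
  then have "smult (lead_coeff p) (\<Prod>z | poly p z = 0. [:-z, 1:] ^ order z p)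
      dvd smult (lead_coeff q) (\<Prod>z | poly q z = 0. [:-z, 1:] ^ order z q)"
    using assms(1) by (intro smult_dvd dvd_smult) auto
  then show ?thesis by (simp only: complex_poly_decompose)
qed auto

lemma order_prod:
  fixes f :: "'b \<Rightarrow> 'a::idom poly"
  assumes "finite A" "\<And>i. i \<in> A \<Longrightarrow> f i \<noteq> 0"
  shows "order z (\<Prod>i\<in>A. f i) = (\<Sum>i\<in>A. order z (f i))"
  using assms by (induction A rule: finite_induct) (auto simp: order_mult)

lemma one_plus_monom_neq_0:
  assumes "m > 0"
  shows "1 + monom a m \<noteq> (0 :: 'a::comm_ring_1 poly)"
proof
  assume "1 + monom a m = 0"
  then have "coeff (1 + monom a m) 0 = 0" by simp
  then show False using assms by simp
qed

lemma degree_one_plus_monom: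
  assumes "a \<noteq> 0" "m > 0"
  shows "degree (1 + monom a m :: 'a::comm_ring_1 poly) = m"
  using assms by (subst degree_add_eq_right) (auto simp: degree_monom_eq)

text \<open>All roots are simple: the derivative is a monomial and can vanish only at
  \<open>0\<close>, where the polynomial has value 1.\<close>

lemma order_one_plus_monom:
  fixes a z :: "'a::field_char_0"
  assumes "a \<noteq> 0" "m > 0"
  shows "order z (1 + monom a m) = (if 1 + a * z ^ m = 0 then 1 else 0)"
proof -
  define p where "p = 1 + monom a m"
  have p0: "p \<noteq> 0" unfolding p_def by (rule one_plus_monom_neq_0) fact
  have root: "poly p z = 1 + a * z ^ m" for z by (simp add: p_def poly_monom)
  have "pderiv p = monom (of_nat m * a) (m - 1)"
    by (simp add: p_def pderiv_add pderiv_monom)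
  then have der: "poly (pderiv p) z = 0 \<longleftrightarrow> z = 0 \<and> m \<noteq> 1" for z
    using assms by (auto simp: poly_monom)
  have "rsquarefree p"
    unfolding rsquarefree_roots using assms by (auto simp: der root power_0_left)
  then have "order z p = (if poly p z = 0 then 1 else 0)"
    using p0 rsquarefree_root_order[of p z] by (simp add: order_0I)
  then show ?thesis by (simp only: root) (simp only: p_def)
qed

lemma order_prod_one_plus_monom:
  fixes a :: "'a::field_char_0"
  assumes "finite A" "a \<noteq> 0" "\<And>i. i \<in> A \<Longrightarrow> e i > 0"
  shows "order z (\<Prod>i\<in>A. 1 + monom a (e i)) = card {i \<in> A. 1 + a * z ^ e i = 0}"
  using assms
  by (simp add: order_prod one_plus_monom_neq_0 order_one_plus_monom sum.If_cases Int_def)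

subsection \<open>Quasi-polynomial coefficients\<close>

text \<open>For \<open>L > 0\<close> this is the expansion of \<open>1 / (1 - x^L)^m\<close>.
  Truncated subtraction gives the binomial the value 1 at \<open>m = n = 0\<close>, so the formula
  covers \<open>m = 0\<close> as well.\<close>

definition inverse_power_series :: "nat \<Rightarrow> nat \<Rightarrow> 'a::comm_ring_1 fps" where
  "inverse_power_series L m =
     Abs_fps (\<lambda>n. if L dvd n then of_nat ((m + n div L - 1) choose (n div L)) else 0)"

lemma inverse_power_series_mult:
  assumes "L > 0"
  shows "inverse_power_series L m * (1 - fps_X ^ L) ^ m = 1"
proof (induction m)
  case 0
  have [simp]: "((t - Suc 0) choose t) = 0" if "t > 0" for t :: nat
    using that by (intro binomial_eq_0) auto
  then show ?case
    using assms by (intro fps_ext) (auto simp: inverse_power_series_def elim!: dvdE)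
next
  case (Suc m)
  \<comment> \<open>Multiplying by \<open>1 - x^L\<close> takes differences along the multiples of
    \<open>L\<close>, which lowers \<open>m\<close> by one according to Pascal's rule.\<close>
  have "inverse_power_series L (Suc m) * (1 - fps_X ^ L) = (inverse_power_series L m :: 'a fps)"
  proof (rule fps_ext)
    fix n
    have "fps_nth (inverse_power_series L (Suc m) * (1 - fps_X ^ L)) n
       = fps_nth (inverse_power_series L (Suc m) :: 'a fps) n
         - (if n < L then 0 else fps_nth (inverse_power_series L (Suc m)) (n - L))"
      by (simp add: algebra_simps fps_X_power_mult_nth)
    also have "\<dots> = fps_nth (inverse_power_series L m) n"
    proof (cases "L dvd n")
      case True
      then obtain t where n: "n = L * t" by blast
      show ?thesis
      proof (cases t)
        case (Suc s)
        have "L * Suc s - L = L * s" by simp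
        then show ?thesis using assms
          by (simp add: n Suc inverse_power_series_def del: mult_Suc_right)
      qed (use assms in \<open>simp add: n inverse_power_series_def\<close>)
    next
      case False
      then have "\<not> L dvd n - L" if "\<not> n < L" using that
        by (metis dvd_diffD dvd_refl linorder_not_less)
      then show ?thesis using False by (simp add: inverse_power_series_def)
    qed
    finally show "fps_nth (inverse_power_series L (Suc m) * (1 - fps_X ^ L)) n
        = fps_nth (inverse_power_series L m :: 'a fps) n" .
  qed
  then show ?case using Suc by (simp add: mult.assoc [symmetric])
qed

lemma prod_add_eq_fact_binomial:
  "(\<Prod>i=1..m. (of_nat i + of_nat s :: 'a::field_char_0)) = fact m * of_nat ((m + s) choose s)"
proof -
  have "fact s * (\<Prod>i=1..m. of_nat i + of_nat s) = (fact (m + s) :: 'a)"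
  proof (induction m)
    case (Suc m)
    have "fact s * (\<Prod>i=1..Suc m. of_nat i + of_nat s :: 'a)
        = (fact s * (\<Prod>i=1..m. of_nat i + of_nat s)) * of_nat (Suc m + s)"
      by simp
    also have "\<dots> = fact (Suc m + s)" unfolding Suc by simp
    finally show ?case .
  qed simp
  then show ?thesis by (simp add: binomial_fact field_simps)
qed

text \<open>With \<open>s = (X - j) / L\<close> this is \<open>(m + s) choose m\<close> as a
  polynomial in \<open>X\<close>, the interpolation of the coefficients of
  \<open>x^j / (1 - x^L)^(m + 1)\<close>.\<close>

definition shifted_binomial :: "nat \<Rightarrow> nat \<Rightarrow> nat \<Rightarrow> 'a::field_char_0 poly" where
  "shifted_binomial L m j =
     smult (1 / fact m) (\<Prod>i=1..m. [:of_nat i - of_nat j / of_nat L, 1 / of_nat L:])"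

lemma degree_shifted_binomial:
  assumes "L > 0"
  shows "degree (shifted_binomial L m j :: 'a::field_char_0 poly) = m"
  using assms unfolding shifted_binomial_def by (simp add: degree_prod_eq_sum_degree)

lemma coeff_shifted_binomial:
  assumes "L > 0"
  shows "coeff (shifted_binomial L m j :: 'a::field_char_0 poly) m = 1 / (fact m * of_nat L ^ m)"
proof -
  have "lead_coeff (shifted_binomial L m j :: 'a poly) = 1 / (fact m * of_nat L ^ m)"
    using assms unfolding shifted_binomial_def by (simp add: lead_coeff_prod power_divide)
  then show ?thesis using assms by (simp add: degree_shifted_binomial)
qed

text \<open>The hypothesis \<open>j < n + L * Suc m\<close> makes the polynomial vanish for those \<open>j > n\<close>, whose
  terms are absent from the Cauchy product.\<close>

lemma poly_shifted_binomial:
  assumes "L > 0" "j mod L = n mod L" "j < n + L * Suc m"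
  shows "poly (shifted_binomial L m j) (of_nat n) =
    (if j \<le> n then fps_nth (inverse_power_series L (Suc m)) (n - j) else (0 :: 'a::field_char_0))"
proof (cases "j \<le> n")
  case True
  then obtain s where s: "n = j + L * s"
    using assms(2) by (metis mod_eqE mod_eq_dvd_iff_nat dvdE le_add_diff_inverse)
  have eq: "poly [:of_nat i - of_nat j / of_nat L, 1 / of_nat L:] (of_nat n) = (of_nat i + of_nat s :: 'a)" for i
    using assms(1) by (simp add: s field_simps)
  have "poly (shifted_binomial L m j) (of_nat n) = (1 / fact m) * (\<Prod>i=1..m. of_nat i + of_nat s :: 'a)"
    by (simp add: shifted_binomial_def poly_prod eq del: poly_pCons)
  then show ?thesis using assms(1) unfolding prod_add_eq_fact_binomial
    by (simp add: inverse_power_series_def s)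
next
  case False
  then obtain s where s: "j = n + L * s"
    using assms(2) by (metis mod_eq_dvd_iff_nat dvdE le_add_diff_inverse nat_le_linear)
  have "s \<in> {1..m}" using assms False by (cases s) (auto simp: s)
  then have zero: "(\<Prod>i=1..m. (of_nat i - of_nat s :: 'a)) = 0"
    by (intro prod_zero) auto
  have eq: "poly [:of_nat i - of_nat j / of_nat L, 1 / of_nat L:] (of_nat n) = (of_nat i - of_nat s :: 'a)" for i
    using assms(1) by (simp add: s field_simps)
  have "poly (shifted_binomial L m j) (of_nat n) = (1 / fact m) * (\<Prod>i=1..m. of_nat i - of_nat s :: 'a)"
    by (simp add: shifted_binomial_def poly_prod eq del: poly_pCons)
  then show ?thesis using False zero by simp
qed

definition residue_sum :: "nat \<Rightarrow> nat \<Rightarrow> 'a::comm_ring_1 poly \<Rightarrow> 'a" where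
  "residue_sum L r p = (\<Sum>j | j \<le> degree p \<and> j mod L = r. coeff p j)"

text \<open>\<open>F\<close> is \<open>R\<close> times the series of
  \<open>1 / (1 - x^L)^(m + 1)\<close>. Only the \<open>j\<close> congruent to \<open>n\<close>
  modulo \<open>L\<close> contribute to the coefficient of \<open>x^n\<close>, each through a
  polynomial in \<open>n\<close> of degree \<open>m\<close> whose leading coefficient is the same
  for all \<open>j\<close>.\<close>

lemma quasi_polynomial_coeffs:
  fixes F :: "'a::field_char_0 fps"
  assumes L: "L > 0" and F: "F * (1 - fps_X ^ L) ^ Suc m = fps_of_poly R"
  obtains Q where
    "\<And>r. degree (Q r) \<le> m"
    "\<And>r. coeff (Q r) m = residue_sum L r R / (fact m * of_nat L ^ m)"
    "\<And>n. degree R < n + L * Suc m \<Longrightarrow> fps_nth F n = poly (Q (n mod L)) (of_nat n)"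
proof
  define J where "J r = {j. j \<le> degree R \<and> j mod L = r}" for r
  have fin: "finite (J r)" for r by (simp add: J_def)
  \<comment> \<open>Indices \<open>j\<close> above \<open>n\<close> are included, so that
    \<open>Q r\<close> does not depend on \<open>n\<close>.\<close>
  define Q :: "nat \<Rightarrow> 'a poly"
    where "Q r = (\<Sum>j\<in>J r. smult (coeff R j) (shifted_binomial L m j))" for r
  show "degree (Q r) \<le> m" for r
    unfolding Q_def using L by (intro degree_sum_le fin)
      (metis degree_shifted_binomial degree_smult_le)
  show "coeff (Q r) m = residue_sum L r R / (fact m * of_nat L ^ m)" for r
    by (simp add: Q_def coeff_sum coeff_shifted_binomial[OF L] residue_sum_def J_def sum_divide_distrib)
  fix n assume n: "degree R < n + L * Suc m"
  let ?H = "inverse_power_series L (Suc m) :: 'a fps"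
  have "F = F * (?H * (1 - fps_X ^ L) ^ Suc m)"
    by (simp only: inverse_power_series_mult[OF L] mult_1_right)
  also have "\<dots> = F * (1 - fps_X ^ L) ^ Suc m * ?H"
    by (simp only: mult_ac)
  also have "\<dots> = fps_of_poly R * ?H"
    by (simp only: F)
  finally have "fps_nth F n = fps_nth (fps_of_poly R * ?H) n"
    by simp
  also have "\<dots> = (\<Sum>j=0..n. coeff R j * fps_nth ?H (n - j))"
    by (simp only: fps_mult_nth fps_of_poly_nth)
  also have "\<dots> = (\<Sum>j\<in>J (n mod L) \<inter> {..n}. coeff R j * fps_nth ?H (n - j))"
  proof (rule sum.mono_neutral_right)
    show "\<forall>j\<in>{0..n} - J (n mod L) \<inter> {..n}. coeff R j * fps_nth ?H (n - j) = 0"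
    proof
      fix j assume j: "j \<in> {0..n} - J (n mod L) \<inter> {..n}"
      then consider "j > degree R" | "j mod L \<noteq> n mod L" by (auto simp: J_def)
      then show "coeff R j * fps_nth ?H (n - j) = 0"
      proof cases
        case 2
        then have "\<not> L dvd n - j" using j mod_eq_dvd_iff_nat[of j n L] by auto
        then show ?thesis by (simp add: inverse_power_series_def)
      qed (simp add: coeff_eq_0)
    qed
  qed auto
  also have "\<dots> = (\<Sum>j\<in>J (n mod L). coeff R j * (if j \<le> n then fps_nth ?H (n - j) else 0))"
    by (rule sum.mono_neutral_cong_left) (auto simp: fin)
  \<comment> \<open>The assumption on \<open>n\<close> enters here:
    \<open>j \<le> degree R < n + L * Suc m\<close>, so the polynomials vanish at the surplus
    indices.\<close>
  also have "\<dots> = (\<Sum>j\<in>J (n mod L). coeff R j * poly (shifted_binomial L m j) (of_nat n))"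
    using n L by (intro sum.cong refl arg_cong2[of _ _ _ _ "(*)"] poly_shifted_binomial[symmetric])
      (auto simp: J_def)
  also have "\<dots> = poly (Q (n mod L)) (of_nat n)"
    by (simp add: Q_def poly_sum)
  finally show "fps_nth F n = poly (Q (n mod L)) (of_nat n)" .
qed

section \<open>Residue class sums from values at roots of unity\<close>

lemma sum_root_of_unity_powers:
  fixes z :: "'a::field"
  assumes "z ^ L = 1"
  shows "(\<Sum>i<L. z ^ i) = (if z = 1 then of_nat L else 0)"
  using assms by (simp add: geometric_sum)

text \<open>The residue sums are the coefficients of the remainder \<open>S\<close> of
  \<open>p\<close> modulo \<open>x^L - 1\<close>. The candidate \<open>T\<close> also has degree
  below \<open>L\<close>, so it suffices that both agree at the \<open>L\<close> roots of
  unity.\<close>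

lemma residue_sum_roots_of_unity:
  fixes p :: "complex poly"
  assumes L: "even L" "L > 0" and r: "r < L"
    and roots: "\<And>z. z ^ L = 1 \<Longrightarrow> z \<noteq> 1 \<Longrightarrow> z \<noteq> -1 \<Longrightarrow> poly p z = 0"
  shows "residue_sum L r p = (poly p 1 + (- 1) ^ r * poly p (- 1)) / of_nat L"
proof -
  define f where "f i = (poly p 1 + (- 1) ^ i * poly p (- 1)) / of_nat L" for i :: nat
  define S where "S = (\<Sum>i<L. monom (residue_sum L i p) i)"
  define T where "T = (\<Sum>i<L. monom (f i) i)"
  have deg: "degree (\<Sum>i<L. monom (g i) i) < L" for g :: "nat \<Rightarrow> complex"
    using L(2) degree_sum_le[of "{..<L}" "\<lambda>i. monom (g i) i" "L - 1"]
    by (fastforce intro: order_trans[OF degree_monom_le])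
  have coeff: "coeff (\<Sum>i<L. monom (g i) i) r = g r" for g :: "nat \<Rightarrow> complex"
    using r by (simp add: coeff_sum)
  have "S = T"
  proof (rule poly_eqI_degree)
    fix z :: complex assume "z \<in> {z. z ^ L = 1}"
    then have z: "z ^ L = 1" by simp
    have "poly S z = (\<Sum>i<L. \<Sum>j | j \<le> degree p \<and> j mod L = i. coeff p j * z ^ i)"
      by (simp add: S_def residue_sum_def poly_sum poly_monom sum_distrib_right)
    also have "\<dots> = (\<Sum>i<L. \<Sum>j | j \<in> {..degree p} \<and> j mod L = i. coeff p j * z ^ (j mod L))"
      by (intro sum.cong) auto
    also have "\<dots> = (\<Sum>j\<le>degree p. coeff p j * z ^ (j mod L))"
      using L(2) by (intro sum.group) auto
    also have "\<dots> = (\<Sum>j\<le>degree p. coeff p j * z ^ j)"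
    proof (intro sum.cong refl)
      fix j
      have "z ^ j = z ^ (L * (j div L) + j mod L)" by simp
      also have "\<dots> = z ^ (j mod L)" by (simp only: power_add power_mult z) simp
      finally show "coeff p j * z ^ (j mod L) = coeff p j * z ^ j" by simp
    qed
    finally have S: "poly S z = poly p z" by (simp add: poly_altdef)
    \<comment> \<open>As \<open>L\<close> is even, both \<open>z\<close> and \<open>- z\<close> are
      roots of unity, and the two geometric sums in \<open>poly T z\<close> detect
      \<open>z = 1\<close> and \<open>z = - 1\<close>.\<close>
    have "(- z) ^ L = 1" using z L by simp
    have "poly T z = (poly p 1 * (\<Sum>i<L. z ^ i) + poly p (- 1) * (\<Sum>i<L. (- z) ^ i)) / of_nat L"
      by (simp add: T_def f_def poly_sum poly_monom sum_distrib_left sum.distrib[symmetric]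
          sum_divide_distrib power_minus[of z] algebra_simps)
    also have "\<dots> = poly p z"
      unfolding sum_root_of_unity_powers[OF z] sum_root_of_unity_powers[OF \<open>(- z) ^ L = 1\<close>]
      using roots[OF z] L(2) by (auto simp: minus_equation_iff[of z])
    finally show "poly S z = poly T z" using S by simp
  qed (use deg card_roots_unity_eq[OF L(2)] in \<open>simp_all add: S_def T_def\<close>)
  then have "coeff S r = coeff T r" by simp
  then show ?thesis by (simp add: S_def T_def coeff f_def)
qed

lemma rat_poly_eventually_pos:
  fixes p :: "rat poly"
  assumes "lead_coeff p > 0"
  shows "\<forall>\<^sub>F n in sequentially. poly p (of_nat n) > 0"
proof -
  have "lead_coeff (map_poly of_rat p :: real poly) > 0"
    using assms by (simp add: degree_map_poly_of_rat coeff_map_poly)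
  then obtain x0 where x0: "\<And>x. x \<ge> x0 \<Longrightarrow> poly (map_poly of_rat p) x > (0::real)"
    using poly_pinfty_gt_lc by (metis less_le_trans)
  have "\<forall>\<^sub>F n in sequentially. real n \<ge> x0" 
    by (rule eventually_mono[OF eventually_ge_at_top[of "nat \<lceil>x0\<rceil>"]]) linarith
  then show ?thesis
  proof eventually_elim
    case (elim n)
    from x0[OF this] have "(of_rat (poly p (of_nat n)) :: real) > 0"
      using poly_map_poly_of_rat[of p "of_nat n", where 'a = real] by simp
    then show ?case by simp
  qed
qed

lemma residue_sum_map_poly_of_rat:
  "residue_sum L r (map_poly of_rat p) = (of_rat (residue_sum L r p) :: 'a::field_char_0)"
  by (simp add: residue_sum_def degree_map_poly_of_rat coeff_map_poly of_rat_sum)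

subsection \<open>Zeros of the numerator and of the denominator\<close>

text \<open>Shift \<open>A\<close> by \<open>Min B\<close> and \<open>B\<close> by
  \<open>Max A\<close>. Both images lie in \<open>C\<close>, one below and one above
  \<open>Max A + Min B\<close>, so they share at most that element.\<close>

lemma card_sumset_ge:
  fixes A B C :: "nat set"
  assumes "finite A" "finite B" "finite C" "A \<noteq> {}" "B \<noteq> {}"
    and sub: "\<And>a b. a \<in> A \<Longrightarrow> b \<in> B \<Longrightarrow> a + b \<in> C"
  shows "card A + card B \<le> Suc (card C)"
proof -
  let ?A = "(\<lambda>a. a + Min B) ` A" and ?B = "(\<lambda>b. Max A + b) ` B"
  have max: "Max A \<in> A" and min: "Min B \<in> B" using assms by auto
  have "?A \<inter> ?B \<subseteq> {Max A + Min B}"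
    using assms by (auto, metis Max_ge Min_le add_le_cancel_left add_le_cancel_right antisym)
  then have "card (?A \<inter> ?B) \<le> 1"
    using card_mono[of "{Max A + Min B}"] by fastforce
  moreover have "card (?A \<union> ?B) \<le> card C"
    using assms by (intro card_mono) (auto intro!: sub max min)
  moreover have "card ?A = card A" "card ?B = card B"
    by (auto intro!: card_image inj_onI)
  moreover have "card ?A + card ?B = card (?A \<union> ?B) + card (?A \<inter> ?B)"
    using assms by (intro card_Un_Int) auto
  ultimately show ?thesis by linarith
qed

text \<open>The order of \<open>z\<close> as a pole is at most \<open>card A + card B - card C\<close>. Multiplying
  \<open>z ^ (K * j + 1) = 1\<close> by \<open>z ^ (K * i - 1) = - 1\<close> shows that \<open>A + B \<subseteq> C\<close>, so that a pole
  to which both factors of the denominator contribute is simple.\<close>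

lemma pole_order_bounds:
  fixes z :: "'a::field_char_0" and K N M :: nat
  assumes K: "K \<ge> 2" and N: "N \<ge> 1" "N \<le> M"
  defines "A \<equiv> {j \<in> {..<M}. z ^ (K * j + 1) = 1}"
    and "B \<equiv> {i \<in> {1..N}. z ^ (K * i - 1) = - 1}"
    and "C \<equiv> {r \<in> {1..N + M - 1}. z ^ (K * r) = - 1}"
  shows "card A + card B \<le> card C + M"
    and "M \<ge> 2 \<Longrightarrow> z \<noteq> 1 \<Longrightarrow> \<not> (z = - 1 \<and> even K \<and> M = N) \<Longrightarrow> card A + card B < card C + M"
proof -
  have fin: "finite A" "finite B" "finite C" by (auto simp: A_def B_def C_def)
  have A_le: "card A \<le> M" using card_mono[of "{..<M}" A] by (auto simp: A_def)
  have B_le: "card B \<le> N" using card_mono[of "{1..N}" B] by (force simp: B_def)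
  have sub: "j + i \<in> C" if "j \<in> A" "i \<in> B" for i j
  proof -
    have "K * (j + i) = (K * j + 1) + (K * i - 1)"
      using that(2) K by (auto simp: B_def algebra_simps)
    then have "z ^ (K * (j + i)) = z ^ (K * j + 1) * z ^ (K * i - 1)"
      by (simp only: power_add)
    also have "\<dots> = - 1" using that by (simp add: A_def B_def)
    finally show ?thesis using that by (auto simp: A_def B_def C_def)
  qed
  have both: "card A + card B \<le> Suc (card C)" if "A \<noteq> {}" "B \<noteq> {}"
    using card_sumset_ge[OF fin that sub] .
  \<comment> \<open>The index \<open>j = 0\<close> lies in \<open>A\<close> only for
    \<open>z = 1\<close>.\<close>
  have A_less: "card A < M" if "z \<noteq> 1"
  proof -
    have "A \<subseteq> {1..<M}" using that by (auto simp: A_def Suc_le_eq intro!: gr0I)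
    then show ?thesis using card_mono[of "{1..<M}" A] N by auto
  qed
  \<comment> \<open>Otherwise \<open>B\<close> contains 1 and 2. Dividing the two equations gives
    \<open>z^K = 1\<close>, hence \<open>z = - 1\<close>, and then \<open>K\<close> is even.\<close>
  have B_less: "card B < M" if "M \<ge> 2" "\<not> (z = - 1 \<and> even K \<and> M = N)"
  proof (rule ccontr)
    assume "\<not> card B < M"
    then have "card B = N" "M = N" using B_le N by auto
    then have "B = {1..N}" by (intro card_subset_eq) (auto simp: B_def)
    then have "1 \<in> B" "2 \<in> B" using that \<open>M = N\<close> by auto
    then have z1: "z ^ (K - 1) = - 1" and z2: "z ^ (K * 2 - 1) = - 1" by (auto simp: B_def)
    have "K * 2 - 1 = K + (K - 1)" using K by simp
    then have "z ^ K = 1" using z1 z2 by (simp add: power_add)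
    moreover have "z ^ K = z * z ^ (K - 1)" using K by (cases K) auto
    ultimately have "z = - 1" using z1 by (simp add: minus_equation_iff)
    with \<open>z ^ K = 1\<close> have "even K" by (cases "even K") auto
    with \<open>z = - 1\<close> \<open>M = N\<close> that show False by auto
  qed
  have B_empty: "B = {}" if "z = 1" using that by (auto simp: B_def)
  \<comment> \<open>If both sets are nonempty, the sumset bound leaves an excess of at most 1 over
    \<open>card C\<close>; otherwise a single cardinality has to be bounded.\<close>
  show "card A + card B \<le> card C + M"
    using both A_le B_le N by (cases "A = {}"; cases "B = {}") auto
  show "card A + card B < card C + M"
    if "M \<ge> 2" "z \<noteq> 1" "\<not> (z = - 1 \<and> even K \<and> M = N)"
    using both A_less[OF that(2)] B_less[OF that(1,3)] that(1)
    by (cases "A = {}"; cases "B = {}") auto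
qed

text \<open>The coefficient ring is left open because coefficients are rational while zeros are
  counted over the complex numbers. All factors here and in \<open>denom\<close> have the shape
  \<open>1 + monom a m\<close>, to which \<open>order_prod_one_plus_monom\<close> applies.\<close>

definition numer :: "nat \<Rightarrow> nat \<Rightarrow> nat \<Rightarrow> 'a::comm_ring_1 poly" where
  "numer k N M = (\<Prod>r=1..N + M - 1. 1 + monom 1 ((k + 1) * r))"

definition denom :: "nat \<Rightarrow> nat \<Rightarrow> nat \<Rightarrow> 'a::comm_ring_1 poly" where
  "denom k N M = (\<Prod>i=1..N. 1 + monom 1 ((k + 1) * i - 1)) * (\<Prod>j<M. 1 + monom (- 1) ((k + 1) * j + 1))"

lemma exponent_pos:
  assumes "k \<ge> 1" "i \<ge> 1"
  shows "(k + 1) * i - 1 > (0 :: nat)"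
proof -
  have "2 * 1 \<le> (k + 1) * i" using assms by (intro mult_le_mono) auto
  then show ?thesis by simp
qed

lemma numer_neq_0: "numer k N M \<noteq> (0 :: 'a::idom poly)"
  by (auto simp: numer_def one_plus_monom_neq_0)

lemma denom_neq_0:
  assumes "k \<ge> 1"
  shows "denom k N M \<noteq> (0 :: 'a::idom poly)"
  using exponent_pos[OF assms] by (auto simp: denom_def one_plus_monom_neq_0)

lemma map_poly_of_rat_numer: "map_poly of_rat (numer k N M) = (numer k N M :: 'a::field_char_0 poly)"
  by (simp add: numer_def map_poly_of_rat_prod map_poly_of_rat_add map_poly_monom)

lemma map_poly_of_rat_denom: "map_poly of_rat (denom k N M) = (denom k N M :: 'a::field_char_0 poly)"
  by (simp add: denom_def map_poly_of_rat_mult map_poly_of_rat_prod map_poly_of_rat_add map_poly_monom of_rat_minus)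

lemma order_numer:
  "order (z :: 'a::field_char_0) (numer k N M) = card {r \<in> {1..N + M - 1}. z ^ ((k + 1) * r) = - 1}"
  unfolding numer_def
  by (subst order_prod_one_plus_monom)
    (auto intro!: arg_cong[where f = card] simp: eq_neg_iff_add_eq_0 add.commute)

lemma order_denom:
  fixes z :: "'a::field_char_0"
  assumes "k \<ge> 1"
  shows "order z (denom k N M) = card {j \<in> {..<M}. z ^ ((k + 1) * j + 1) = 1}
    + card {i \<in> {1..N}. z ^ ((k + 1) * i - 1) = - 1}"
proof -
  have "order z (denom k N M :: 'a poly) = order z (\<Prod>i=1..N. 1 + monom 1 ((k + 1) * i - 1))
      + order z (\<Prod>j<M. 1 + monom (- 1) ((k + 1) * j + 1))"
    using denom_neq_0[OF assms, of N M, where 'a = 'a] unfolding denom_def by (rule order_mult)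
  also have "order z (\<Prod>i=1..N. 1 + monom 1 ((k + 1) * i - 1)) = card {i \<in> {1..N}. z ^ ((k + 1) * i - 1) = - 1}"
    using exponent_pos[OF assms]
    by (subst order_prod_one_plus_monom)
      (auto intro!: arg_cong[where f = card] simp: eq_neg_iff_add_eq_0 add.commute simp del: mult_Suc)
  also have "order z (\<Prod>j<M. 1 + monom (- 1) ((k + 1) * j + 1)) = card {j \<in> {..<M}. z ^ ((k + 1) * j + 1) = 1}"
    by (subst order_prod_one_plus_monom) (auto intro!: arg_cong[where f = card])
  finally show ?thesis by simp
qed

text \<open>This is the origin of \<open>Delta\<close>: it is the degree of \<open>G\<close> as a
  rational function.\<close>

lemma degree_numer_denom:
  assumes "k \<ge> 1" "N \<ge> 1" "M \<ge> 1"
  shows "int (degree (numer k N M :: 'a::field_char_0 poly)) = int (degree (denom k N M :: 'a poly)) + Delta k N M"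
proof -
  have num: "degree (numer k N M :: 'a poly) = (\<Sum>r=1..N + M - 1. (k + 1) * r)"
    unfolding numer_def
    by (subst degree_prod_eq_sum_degree) (auto simp: one_plus_monom_neq_0 degree_one_plus_monom simp del: mult_Suc)
  have "degree (denom k N M :: 'a poly) = degree (\<Prod>i=1..N. 1 + monom 1 ((k + 1) * i - 1) :: 'a poly)
      + degree (\<Prod>j<M. 1 + monom (- 1) ((k + 1) * j + 1) :: 'a poly)"
    using denom_neq_0[OF assms(1), of N M, where 'a = 'a] unfolding denom_def by (intro degree_mult_eq) auto
  also have "degree (\<Prod>i=1..N. 1 + monom 1 ((k + 1) * i - 1) :: 'a poly) = (\<Sum>i=1..N. (k + 1) * i - 1)"
    using exponent_pos[OF assms(1)]
    by (subst degree_prod_eq_sum_degree) (auto simp: one_plus_monom_neq_0 degree_one_plus_monom simp del: mult_Suc)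
  also have "degree (\<Prod>j<M. 1 + monom (- 1) ((k + 1) * j + 1) :: 'a poly) = (\<Sum>j<M. (k + 1) * j + 1)"
    by (subst degree_prod_eq_sum_degree) (auto simp: one_plus_monom_neq_0 degree_one_plus_monom simp del: mult_Suc)
  finally have den: "degree (denom k N M :: 'a poly) = (\<Sum>i=1..N. (k + 1) * i - 1) + (\<Sum>j<M. (k + 1) * j + 1)" .
  \<comment> \<open>The sums are doubled so that their closed forms need no division.\<close>
  have s1: "2 * int (\<Sum>r=1..n. (k + 1) * r) = (int k + 1) * int n * (int n + 1)" for n
    by (induction n) (auto simp: algebra_simps)
  have s2: "2 * int (\<Sum>i=1..n. (k + 1) * i - 1) = (int k + 1) * int n * (int n + 1) - 2 * int n" for n
    by (induction n) (auto simp: algebra_simps of_nat_diff)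
  have s3: "2 * int (\<Sum>j<n. (k + 1) * j + 1) = (int k + 1) * (int n - 1) * int n + 2 * int n" for n
    by (induction n) (auto simp: algebra_simps)
  have "2 * int (degree (numer k N M :: 'a poly)) = 2 * (int (degree (denom k N M :: 'a poly)) + Delta k N M)"
    unfolding num den of_nat_add distrib_left s1 s2 s3 Delta_def
    using assms by (simp add: of_nat_diff algebra_simps)
  then show ?thesis by simp
qed

subsection \<open>The reduced numerator\<close>

lemma Lam_pos:
  assumes "k \<ge> 1"
  shows "Lam k N M > 0"
proof -
  let ?X = "{(k + 1) * j + 1 | j. j < M} \<union> {2 * (k + 1) * i - 2 | i. 1 \<le> i \<and> i \<le> N}"
  have "finite ?X" by (intro finite_UnI finite_image_set) auto
  moreover have "0 \<notin> ?X"
  proof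
    assume "0 \<in> ?X"
    then obtain i where "1 \<le> i" "2 * (k + 1) * i - 2 = 0" by auto
    then show False using exponent_pos[OF assms, of i] by (simp add: algebra_simps)
  qed
  ultimately have "Lcm ?X \<noteq> 0" using Lcm_0_iff[of ?X] by blast
  then show ?thesis unfolding Lam_def by (rule neq0_conv[THEN iffD1])
qed

lemma dvd_Lam:
  "j < M \<Longrightarrow> (k + 1) * j + 1 dvd Lam k N M"
  "1 \<le> i \<Longrightarrow> i \<le> N \<Longrightarrow> 2 * ((k + 1) * i - 1) dvd Lam k N M"
  unfolding Lam_def by (intro dvd_Lcm; force simp: algebra_simps)+

lemma even_Lam:
  assumes "N \<ge> 1"
  shows "even (Lam k N M)"
  using dvd_Lam(2)[of 1 N k M] assms by (auto elim: dvd_trans[rotated])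

lemma order_one_minus_monom_power:
  fixes z :: "'a::field_char_0"
  assumes "L > 0"
  shows "order z ((1 + monom (- 1) L) ^ M) = (if z ^ L = 1 then M else 0)"
  using order_prod_one_plus_monom[of "{..<M}" "- 1 :: 'a" "\<lambda>_. L" z] assms by auto

text \<open>Multiplicities are compared. At \<open>L\<close>-th roots of unity the power contributes
  \<open>M\<close>, which suffices by \<open>pole_order_bounds\<close>; elsewhere
  \<open>denom\<close> has no zeros.\<close>

lemma denom_dvd:
  assumes k: "k \<ge> 1" and N: "N \<ge> 1" "N \<le> M"
  shows "denom k N M dvd (numer k N M * (1 + monom (- 1) (Lam k N M)) ^ M :: complex poly)"
proof (rule complex_poly_dvdI_order)
  let ?L = "Lam k N M"
  show "denom k N M \<noteq> (0 :: complex poly)" using denom_neq_0[OF k] .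
  fix z :: complex
  have nz: "numer k N M * (1 + monom (- 1) ?L) ^ M \<noteq> (0 :: complex poly)"
    using Lam_pos[OF k] by (simp add: numer_neq_0 one_plus_monom_neq_0)
  have "order z (denom k N M) \<le> order z (numer k N M) + order z ((1 + monom (- 1) ?L) ^ M)"
  proof (cases "z ^ ?L = 1")
    case True
    then show ?thesis
      using pole_order_bounds(1)[of "k + 1" N M z] k N
      by (simp only: order_numer order_denom[OF k] order_one_minus_monom_power[OF Lam_pos[OF k]])
        simp
  next
    case False
    \<comment> \<open>The exponents in the first family divide \<open>Lam k N M\<close>. In the
      second family \<open>z^e = - 1\<close> only gives \<open>z^(2 * e) = 1\<close>, which is why
      \<open>Lam\<close> contains the doubled exponents.\<close>
    have A: "z ^ ((k + 1) * j + 1) \<noteq> 1" if "j < M" for j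
      using dvd_Lam(1)[OF that, of k N] False by (metis dvdE power_mult power_one)
    have B: "z ^ ((k + 1) * i - 1) \<noteq> - 1" if "1 \<le> i" "i \<le> N" for i
    proof
      assume "z ^ ((k + 1) * i - 1) = - 1"
      then have "z ^ (2 * ((k + 1) * i - 1)) = 1"
        by (simp only: mult.commute[of 2] power_mult) simp
      then show False
        using dvd_Lam(2)[OF that, of k M] False by (metis dvdE power_mult power_one)
    qed
    have "{j \<in> {..<M}. z ^ ((k + 1) * j + 1) = 1} = {}"
      unfolding set_eq_iff mem_Collect_eq lessThan_iff empty_iff using A by blast
    moreover have "{i \<in> {1..N}. z ^ ((k + 1) * i - 1) = - 1} = {}"
      unfolding set_eq_iff mem_Collect_eq atLeastAtMost_iff empty_iff using B by blast
    ultimately show ?thesis unfolding order_denom[OF k] by (simp only: card.empty)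
  qed
  then show "order z (denom k N M) \<le> order z (numer k N M * (1 + monom (- 1) ?L) ^ M)"
    by (simp add: order_mult[OF nz])
qed

definition reduced_numer :: "nat \<Rightarrow> nat \<Rightarrow> nat \<Rightarrow> rat poly" where
  "reduced_numer k N M = numer k N M * (1 + monom (- 1) (Lam k N M)) ^ M div denom k N M"

text \<open>The divisibility, obtained from complex roots, descends to rational polynomials.\<close>

lemma reduced_numer:
  assumes "k \<ge> 1" "N \<ge> 1" "N \<le> M"
  shows "reduced_numer k N M * denom k N M = numer k N M * (1 + monom (- 1) (Lam k N M)) ^ M"
proof -
  have "denom k N M dvd (numer k N M * (1 + monom (- 1) (Lam k N M)) ^ M :: rat poly)"
    by (rule map_poly_of_rat_dvdD[where 'a = complex])
      (use denom_dvd[OF assms] in \<open>simp add: map_poly_of_rat_mult map_poly_of_rat_power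
        map_poly_of_rat_add map_poly_monom map_poly_of_rat_numer map_poly_of_rat_denom of_rat_minus\<close>)
  then show ?thesis unfolding reduced_numer_def by (rule dvd_div_mult_self)
qed

text \<open>This turns the degree condition of \<open>quasi_polynomial_coeffs\<close> into
  \<open>n > Delta k N M\<close>.\<close>

lemma degree_reduced_numer:
  assumes k: "k \<ge> 1" and N: "N \<ge> 1" "N \<le> M"
  shows "int (degree (reduced_numer k N M)) = Delta k N M + int (Lam k N M * M)"
proof -
  let ?p = "1 + monom (- 1) (Lam k N M) :: rat poly"
  have L: "Lam k N M > 0" using Lam_pos[OF k] .
  have deg: "degree (?p ^ M) = Lam k N M * M"
    using degree_power_eq[OF one_plus_monom_neq_0[OF L, of "- 1 :: rat"], of M] L
    by (simp add: degree_one_plus_monom mult.commute)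
  have nz: "numer k N M * ?p ^ M \<noteq> 0"
    using L by (simp add: numer_neq_0 one_plus_monom_neq_0)
  then have "reduced_numer k N M \<noteq> 0" using reduced_numer[OF assms] by auto
  then have "degree (reduced_numer k N M) + degree (denom k N M :: rat poly) = degree (numer k N M * ?p ^ M)"
    unfolding reduced_numer[OF assms, symmetric] using denom_neq_0[OF k, of N M, where 'a = rat] by (simp add: degree_mult_eq)
  also have "\<dots> = degree (numer k N M :: rat poly) + Lam k N M * M"
    using nz by (simp add: degree_mult_eq deg)
  finally show ?thesis
    using degree_numer_denom[of k N M, where 'a = rat] k N by linarith
qed

lemma poly_reduced_numer_eq_0:
  fixes z :: complex
  assumes k: "k \<ge> 1" and N: "N \<ge> 1" "N \<le> M"
    and z: "z ^ Lam k N M = 1" "M \<ge> 2" "z \<noteq> 1" "\<not> (z = - 1 \<and> odd k \<and> M = N)"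
  shows "poly (map_poly of_rat (reduced_numer k N M)) z = 0"
proof -
  let ?p = "1 + monom (- 1) (Lam k N M) :: complex poly"
  let ?R = "map_poly of_rat (reduced_numer k N M) :: complex poly"
  have "map_poly of_rat (reduced_numer k N M * denom k N M)
      = (map_poly of_rat (numer k N M * (1 + monom (- 1) (Lam k N M)) ^ M) :: complex poly)"
    using reduced_numer[OF k N] by simp
  then have eq: "?R * denom k N M = numer k N M * ?p ^ M"
    by (simp add: map_poly_of_rat_mult map_poly_of_rat_power map_poly_of_rat_add map_poly_monom
        map_poly_of_rat_numer map_poly_of_rat_denom of_rat_minus)
  have nz: "numer k N M * ?p ^ M \<noteq> 0"
    using Lam_pos[OF k] by (simp add: numer_neq_0 one_plus_monom_neq_0)
  have "order z ?R + order z (denom k N M) = order z (numer k N M) + order z (?p ^ M)"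
    using order_mult[OF nz, of z] order_mult[of ?R "denom k N M" z] nz by (simp add: eq)
  moreover have "order z (denom k N M) < order z (numer k N M) + order z (?p ^ M)"
    using pole_order_bounds(2)[of "k + 1" N M z] k N z
    by (simp only: order_numer order_denom[OF k] order_one_minus_monom_power[OF Lam_pos[OF k]])
      simp
  ultimately show ?thesis by (simp add: order_root)
qed

section \<open>Values of the reduced numerator at 1 and -1\<close>

text \<open>The parameter serves both points: \<open>a = 1\<close> splits \<open>1 - x\<close> off
  \<open>1 - x^m\<close>, and \<open>a = - 1\<close> splits \<open>1 + x\<close> off
  \<open>1 - x^m\<close> for even \<open>m\<close> and off \<open>1 + x^m\<close> for odd
  \<open>m\<close>.\<close>

lemma one_minus_monom_factor:
  "1 + monom (- (a ^ m)) m = [:1, - a:] * (\<Sum>i<m. monom (a ^ i) i :: 'a::field_char_0 poly)"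
proof (rule poly_ext)
  fix x
  have "poly (1 + monom (- (a ^ m)) m) x = 1 - (a * x) ^ m"
    by (simp add: poly_monom power_mult_distrib)
  also have "\<dots> = (1 - a * x) * (\<Sum>i<m. (a * x) ^ i)"
    by (rule one_diff_power_eq)
  also have "\<dots> = poly ([:1, - a:] * (\<Sum>i<m. monom (a ^ i) i)) x"
  proof -
    have "poly (\<Sum>i<m. monom (a ^ i) i) x = (\<Sum>i<m. (a * x) ^ i)"
      by (simp add: poly_sum poly_monom power_mult_distrib)
    moreover have "poly [:1, - a:] x = 1 - a * x" by simp
    ultimately show ?thesis by (simp only: poly_mult)
  qed
  finally show "poly (1 + monom (- (a ^ m)) m) x = poly ([:1, - a:] * (\<Sum>i<m. monom (a ^ i) i)) x" .
qed

lemma poly_geometric_sum: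
  assumes "a * x = (1 :: 'a::field_char_0)"
  shows "poly (\<Sum>i<m. monom (a ^ i) i) x = of_nat m"
  using assms by (simp add: poly_sum poly_monom flip: power_mult_distrib)

lemma poly_reduced_numer_1:
  assumes k: "k \<ge> 1" and N: "N \<ge> 1" "N \<le> M"
  shows "poly (reduced_numer k N M) 1 = 2 ^ (M - 1) * of_nat (Lam k N M) ^ M / (\<Prod>j<M. of_nat ((k + 1) * j + 1))"
proof -
  let ?R = "reduced_numer k N M" and ?L = "Lam k N M"
  let ?g = "\<lambda>m. \<Sum>i<m. monom 1 i :: rat poly"
  let ?b = "\<Prod>i=1..N. 1 + monom 1 ((k + 1) * i - 1) :: rat poly"
  have f: "1 + monom (- 1) m = [:1, - 1:] * ?g m" for m
    using one_minus_monom_factor[of "1 :: rat" m] by simp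
  have g: "poly (?g m) 1 = of_nat m" for m
    by (simp add: poly_sum poly_monom)
  \<comment> \<open>After cancelling \<open>(1 - x)^M\<close>, at 1 each factor
    \<open>1 - x^m\<close> has become \<open>m\<close> and each factor \<open>1 + x^m\<close> is
    2.\<close>
  have "[:1, - 1:] ^ M * (?R * (?b * (\<Prod>j<M. ?g ((k + 1) * j + 1))))
      = [:1, - 1:] ^ M * (numer k N M * ?g ?L ^ M)"
    using reduced_numer[OF assms]
    unfolding denom_def f by (simp only: prod.distrib prod_constant card_lessThan power_mult_distrib mult_ac)
  then have "?R * (?b * (\<Prod>j<M. ?g ((k + 1) * j + 1))) = numer k N M * ?g ?L ^ M"
    by (subst (asm) mult_left_cancel) auto
  then have "poly (?R * (?b * (\<Prod>j<M. ?g ((k + 1) * j + 1)))) 1 = poly (numer k N M * ?g ?L ^ M) 1"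
    by simp
  then have "poly ?R 1 * (2 ^ N * (\<Prod>j<M. of_nat ((k + 1) * j + 1))) = 2 ^ (N + M - 1) * of_nat ?L ^ M"
    unfolding poly_mult poly_prod poly_power g numer_def poly_add poly_monom poly_1 by simp
  moreover have "(2 :: rat) ^ (N + M - 1) = 2 ^ N * 2 ^ (M - 1)"
    using N by (simp flip: power_add)
  moreover have "(\<Prod>j<M. of_nat ((k + 1) * j + 1)) \<noteq> (0 :: rat)"
    by (auto simp del: of_nat_add of_nat_mult of_nat_Suc)
  ultimately show ?thesis by (simp add: field_simps)
qed

text \<open>For odd \<open>k\<close> all exponents in \<open>denom\<close> are odd, so at -1 its two
  families exchange roles: the factors \<open>1 + x^m\<close> vanish and the factors
  \<open>1 - x^m\<close> equal 2. As \<open>M = N\<close>, the zeros on both sides cancel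
  exactly.\<close>

lemma poly_reduced_numer_minus_1:
  assumes k: "k \<ge> 1" "odd k" and N: "N \<ge> 1"
  shows "poly (reduced_numer k N N) (- 1) = 2 ^ (N - 1) * of_nat (Lam k N N) ^ N / (\<Prod>i=1..N. of_nat ((k + 1) * i - 1))"
proof -
  let ?R = "reduced_numer k N N" and ?L = "Lam k N N"
  let ?g = "\<lambda>m. \<Sum>i<m. monom ((- 1) ^ i) i :: rat poly"
  let ?a = "\<Prod>j<N. 1 + monom (- 1) ((k + 1) * j + 1) :: rat poly"
  have fe: "1 + monom (- 1) m = [:1, 1:] * ?g m" if "even m" for m
    using one_minus_monom_factor[of "- 1 :: rat" m] that by simp
  have fo: "1 + monom 1 m = [:1, 1:] * ?g m" if "odd m" for m
    using one_minus_monom_factor[of "- 1 :: rat" m] that by simp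
  have g: "poly (?g m) (- 1) = of_nat m" for m
    by (rule poly_geometric_sum) simp
  have odd: "odd ((k + 1) * i - 1)" if "i \<ge> 1" for i
    using exponent_pos[OF k(1) that] k(2) by auto
  have b: "(\<Prod>i=1..N. 1 + monom 1 ((k + 1) * i - 1)) = [:1, 1:] ^ N * (\<Prod>i=1..N. ?g ((k + 1) * i - 1))"
  proof -
    have "(\<Prod>i=1..N. 1 + monom 1 ((k + 1) * i - 1)) = (\<Prod>i=1..N. [:1, 1:] * ?g ((k + 1) * i - 1))"
      by (intro prod.cong refl fo odd) auto
    then show ?thesis
      by (simp only: prod.distrib prod_constant card_atLeastAtMost One_nat_def diff_Suc_Suc minus_nat.diff_0)
  qed
  have "[:1, 1:] ^ N * (?R * ((\<Prod>i=1..N. ?g ((k + 1) * i - 1)) * ?a))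
      = [:1, 1:] ^ N * (numer k N N * ?g ?L ^ N)"
    using reduced_numer[OF k(1) N order_refl]
    unfolding denom_def b fe[OF even_Lam[OF N]] by (simp only: power_mult_distrib mult_ac)
  then have "?R * ((\<Prod>i=1..N. ?g ((k + 1) * i - 1)) * ?a) = numer k N N * ?g ?L ^ N"
    by (subst (asm) mult_left_cancel) auto
  then have "poly (?R * ((\<Prod>i=1..N. ?g ((k + 1) * i - 1)) * ?a)) (- 1) = poly (numer k N N * ?g ?L ^ N) (- 1)"
    by simp
  then have "poly ?R (- 1) * ((\<Prod>i=1..N. of_nat ((k + 1) * i - 1)) * 2 ^ N) = 2 ^ (N + N - 1) * of_nat ?L ^ N"
    unfolding poly_mult poly_prod poly_power g numer_def poly_add poly_monom poly_1
    using k(2) by simp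
  moreover have "(2 :: rat) ^ (N + N - 1) = 2 ^ N * 2 ^ (N - 1)"
    using N by (simp flip: power_add)
  moreover have "(\<Prod>i=1..N. of_nat ((k + 1) * i - 1)) \<noteq> (0 :: rat)"
    unfolding prod_zero_iff[OF finite_atLeastAtMost] of_nat_eq_0_iff
    using exponent_pos[OF k(1)] by (metis atLeastAtMost_iff less_irrefl)
  ultimately show ?thesis by (simp add: field_simps)
qed

section \<open>Passage from polynomials to the power series \<open>G\<close>\<close>

lemma fps_of_poly_numer:
  "fps_of_poly (numer k N M) = (\<Prod>r=1..N + M - 1. 1 + fps_X ^ ((k + 1) * r) :: 'a::field_char_0 fps)"
  by (simp add: numer_def fps_of_poly_prod fps_of_poly_add fps_of_poly_monom')

lemma fps_of_poly_one_minus_monom: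
  "fps_of_poly (1 + monom (- 1) m) = (1 - fps_X ^ m :: 'a::field_char_0 fps)"
  by (simp add: fps_of_poly_diff fps_of_poly_monom' flip: minus_monom)

lemma fps_of_poly_denom:
  "fps_of_poly (denom k N M) =
    (\<Prod>i=1..N. 1 + fps_X ^ ((k + 1) * i - 1)) * (\<Prod>j<M. 1 - fps_X ^ ((k + 1) * j + 1) :: 'a::field_char_0 fps)"
  unfolding denom_def fps_of_poly_mult fps_of_poly_prod fps_of_poly_one_minus_monom
  by (simp add: fps_of_poly_add fps_of_poly_monom')

lemma G_mult_denom:
  assumes "k \<ge> 1"
  shows "G k N M * fps_of_poly (denom k N M) = fps_of_poly (numer k N M)"
proof -
  have "coeff (denom k N M) 0 = (1 :: rat)"
    using exponent_pos[OF assms]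
    by (auto simp: denom_def poly_prod poly_monom zero_power simp flip: poly_0_coeff_0 intro!: prod.neutral)
  then have "is_unit (fps_of_poly (denom k N M) :: rat fps)" by simp
  then show ?thesis
    unfolding G_expanded fps_of_poly_numer[symmetric] fps_of_poly_denom[symmetric]
    by (rule dvd_div_mult_self[OF unit_imp_dvd])
qed

lemma G_mult_power:
  assumes "k \<ge> 1" "N \<ge> 1" "N \<le> M"
  shows "G k N M * (1 - fps_X ^ Lam k N M) ^ M = fps_of_poly (reduced_numer k N M)"
proof -
  let ?d = "fps_of_poly (denom k N M) :: rat fps"
  have "G k N M * (1 - fps_X ^ Lam k N M) ^ M * ?d = G k N M * ?d * (1 - fps_X ^ Lam k N M) ^ M"
    by (simp only: mult_ac)
  also have "\<dots> = fps_of_poly (numer k N M * (1 + monom (- 1) (Lam k N M)) ^ M)"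
    unfolding G_mult_denom[OF assms(1)] fps_of_poly_mult fps_of_poly_power fps_of_poly_one_minus_monom ..
  also have "\<dots> = fps_of_poly (reduced_numer k N M) * ?d"
    by (simp only: reduced_numer[OF assms, symmetric] fps_of_poly_mult)
  finally show ?thesis
    using denom_neq_0[OF assms(1), of N M, where 'a = rat]
    by (subst (asm) mult_right_cancel) (auto simp flip: fps_of_poly_0)
qed

text \<open>Only the values at 1 and -1 survive in the sum over roots of unity. Both carry the
  factor \<open>L^M\<close>, which cancels against \<open>L * L^(M - 1)\<close>.\<close>

lemma residue_sum_reduced_numer:
  assumes k: "k \<ge> 1" and N: "N \<ge> 1" "N \<le> M" "M \<ge> 2" and r: "r < Lam k N M"
  shows "residue_sum (Lam k N M) r (reduced_numer k N M) / (fact (M - 1) * of_nat (Lam k N M) ^ (M - 1)) =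
    1 / fact (M - 1) * (2 ^ (M - 1) / (\<Prod>j<M. of_nat ((k + 1) * j + 1)) +
      (if M = N \<and> odd k then (- 1) ^ r * (2 ^ (N - 1) / (\<Prod>i=1..N. of_nat ((k + 1) * i - 1))) else 0))"
proof -
  let ?L = "Lam k N M" and ?R = "reduced_numer k N M"
  have L: "?L > 0" using Lam_pos[OF k] .
  have "residue_sum ?L r (map_poly of_rat ?R) =
      (poly (map_poly of_rat ?R) 1 + (- 1) ^ r * poly (map_poly of_rat ?R) (- 1)) / (of_nat ?L :: complex)"
    using poly_reduced_numer_eq_0[OF k N(1,2) _ N(3)] even_Lam[OF N(1)] L r
    by (intro residue_sum_roots_of_unity) auto
  then have "(of_rat (residue_sum ?L r ?R) :: complex) =
      of_rat ((poly ?R 1 + (- 1) ^ r * poly ?R (- 1)) / of_nat ?L)"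
    using poly_map_poly_of_rat[of ?R 1, where 'a = complex] poly_map_poly_of_rat[of ?R "- 1", where 'a = complex]
    by (simp add: residue_sum_map_poly_of_rat of_rat_divide of_rat_add of_rat_mult of_rat_power of_rat_minus)
  then have S: "residue_sum ?L r ?R = (poly ?R 1 + (- 1) ^ r * poly ?R (- 1)) / of_nat ?L"
    by (simp only: of_rat_eq_iff)
  let ?e = "if M = N \<and> odd k then 2 ^ (N - 1) / (\<Prod>i=1..N. of_nat ((k + 1) * i - 1)) else 0 :: rat"
  have R_minus_1: "poly ?R (- 1) = of_nat ?L ^ M * ?e"
  proof (cases "M = N \<and> odd k")
    case True
    then show ?thesis using poly_reduced_numer_minus_1[OF k _ N(1)] by simp
  next
    case False
    then have "poly (map_poly of_rat ?R) (- 1 :: complex) = 0"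
      using even_Lam[OF N(1)] by (intro poly_reduced_numer_eq_0[OF k N(1,2) _ N(3)]) auto
    then have "(of_rat (poly ?R (- 1)) :: complex) = 0"
      using poly_map_poly_of_rat[of ?R "- 1", where 'a = complex] by (simp add: of_rat_minus)
    then have "poly ?R (- 1) = 0" by (simp only: of_rat_eq_0_iff)
    then show ?thesis by (simp only: if_not_P[OF False] mult_zero_right)
  qed
  have R_1: "poly ?R 1 = of_nat ?L ^ M * (2 ^ (M - 1) / (\<Prod>j<M. of_nat ((k + 1) * j + 1)))"
    using poly_reduced_numer_1[OF k N(1,2)] by simp
  have L_M: "(of_nat ?L :: rat) ^ M = of_nat ?L * of_nat ?L ^ (M - 1)"
    using N by (cases M) auto
  have e: "(if M = N \<and> odd k then (- 1) ^ r * (2 ^ (N - 1) / (\<Prod>i=1..N. of_nat ((k + 1) * i - 1))) else 0)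
      = (- 1) ^ r * ?e"
    by simp
  have alg: "(l * l' * a + s * (l * l' * b)) / l / (f * l') = 1 / f * (a + s * b)"
    if "l \<noteq> 0" "l' \<noteq> 0" "f \<noteq> 0" for l l' a s b f :: rat
    using that by (simp add: field_simps)
  show ?thesis
    unfolding e S R_minus_1 R_1 L_M by (rule alg) (use L in simp_all)
qed

section \<open>Positivity of the leading coefficients\<close>

text \<open>The factors compare one by one: \<open>(k + 1) * j + 1 < (k + 1) * j + k\<close>, as
  \<open>k > 1\<close>.\<close>

lemma prod_less_prod_shifted:
  fixes k N :: nat
  assumes "k > 1" "N \<ge> 1"
  shows "(\<Prod>j<N. of_nat ((k + 1) * j + 1)) < (\<Prod>i=1..N. of_nat ((k + 1) * i - 1) :: rat)"
proof -
  have less: "of_nat ((k + 1) * j + 1) < (of_nat ((k + 1) * Suc j - 1) :: rat)" for j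
    unfolding of_nat_less_iff using assms(1) by simp
  have "(\<Prod>j<N. of_nat ((k + 1) * j + 1)) < (\<Prod>j<N. of_nat ((k + 1) * Suc j - 1) :: rat)"
  proof (rule prod_mono_strict)
    show "0 \<in> {..<N}" using assms(2) by simp
  qed (use less less_imp_le[OF less] le_less_trans[OF of_nat_0_le_iff less] of_nat_0_le_iff in blast)+
  also have "\<dots> = (\<Prod>i=1..N. of_nat ((k + 1) * i - 1))"
    by (rule prod.reindex_bij_witness[where i = "\<lambda>r. r - 1" and j = Suc]) auto
  finally show ?thesis .
qed

text \<open>The contribution of -1 has the larger denominator and so cannot outweigh that of
  1.\<close>

lemma leading_coeff_pos:
  fixes k N M r :: nat
  assumes "k \<ge> 1" "N \<ge> 1" "\<not> (M = N \<and> k = 1)"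
  shows "0 < 1 / fact (M - 1) * (2 ^ (M - 1) / (\<Prod>j<M. of_nat ((k + 1) * j + 1)) +
      (if M = N \<and> odd k then (- 1) ^ r * (2 ^ (N - 1) / (\<Prod>i=1..N. of_nat ((k + 1) * i - 1))) else (0::rat)))"
proof -
  let ?a = "\<Prod>j<M. of_nat ((k + 1) * j + 1) :: rat" and ?b = "\<Prod>i=1..N. of_nat ((k + 1) * i - 1) :: rat"
  have a: "?a > 0" by (intro prod_pos) (auto simp del: of_nat_add of_nat_mult of_nat_Suc)
  have bound: "\<bar>(- 1) ^ r * (2 ^ (N - 1) / ?b)\<bar> < 2 ^ (M - 1) / ?a" if "M = N" "odd k"
  proof -
    have "?a < ?b" using prod_less_prod_shifted[of k N] assms that by auto
    then show ?thesis using a that by (simp add: abs_mult power_abs frac_less2)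
  qed
  have "0 < 2 ^ (M - 1) / ?a + (if M = N \<and> odd k then (- 1) ^ r * (2 ^ (N - 1) / ?b) else 0)"
  proof (cases "M = N \<and> odd k")
    case True
    have "0 < y + x" if "\<bar>x\<bar> < y" for x y :: rat using that by linarith
    from this[OF bound[OF True[THEN conjunct1] True[THEN conjunct2]]]
    show ?thesis unfolding if_P[OF True] .
  next
    case False
    then show ?thesis unfolding if_not_P[OF False] using a by simp
  qed
  then show ?thesis by (intro mult_pos_pos) auto
qed

lemma G_quasi_polynomial:
  assumes k: "k \<ge> 1" and N: "N \<ge> 1" "N \<le> M"
  obtains Q :: "nat \<Rightarrow> rat poly" where
    "\<And>r. degree (Q r) \<le> M - 1"
    "\<And>n. int n > Delta k N M \<Longrightarrow> c k N M n = poly (Q (n mod Lam k N M)) (of_nat n)"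
    "\<And>r. M \<ge> 2 \<Longrightarrow> \<not> (M = N \<and> k = 1) \<Longrightarrow> r < Lam k N M \<Longrightarrow>
      degree (Q r) = M - 1 \<and> lead_coeff (Q r) = 1 / fact (M - 1) *
        (2 ^ (M - 1) / (\<Prod>j<M. of_nat ((k + 1) * j + 1)) +
        (if M = N \<and> odd k then (- 1) ^ r * (2 ^ (N - 1) / (\<Prod>i=1..N. of_nat ((k + 1) * i - 1))) else 0))"
proof -
  let ?L = "Lam k N M"
  have M: "Suc (M - 1) = M" using N by simp
  have "G k N M * (1 - fps_X ^ ?L) ^ Suc (M - 1) = fps_of_poly (reduced_numer k N M)"
    unfolding M by (rule G_mult_power[OF assms])
  then obtain Q where Q: "\<And>r. degree (Q r) \<le> M - 1"
    "\<And>r. coeff (Q r) (M - 1) = residue_sum ?L r (reduced_numer k N M) / (fact (M - 1) * of_nat ?L ^ (M - 1))"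
    "\<And>n. degree (reduced_numer k N M) < n + ?L * Suc (M - 1) \<Longrightarrow>
      fps_nth (G k N M) n = poly (Q (n mod ?L)) (of_nat n)"
    using quasi_polynomial_coeffs[OF Lam_pos[OF k]] by metis
  show thesis
  proof (rule that[of Q])
    show "degree (Q r) \<le> M - 1" for r by (rule Q)
    show "c k N M n = poly (Q (n mod ?L)) (of_nat n)" if "int n > Delta k N M" for n
    proof -
      have "int (degree (reduced_numer k N M)) < int (n + ?L * M)"
        using that degree_reduced_numer[OF assms] by simp
      then show ?thesis unfolding c_def by (intro Q(3)) (simp only: M of_nat_less_iff)
    qed
    fix r assume r: "M \<ge> 2" "\<not> (M = N \<and> k = 1)" "r < ?L"
    let ?l = "1 / fact (M - 1) * (2 ^ (M - 1) / (\<Prod>j<M. of_nat ((k + 1) * j + 1)) +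
        (if M = N \<and> odd k then (- 1) ^ r * (2 ^ (N - 1) / (\<Prod>i=1..N. of_nat ((k + 1) * i - 1))) else 0)) :: rat"
    have l: "coeff (Q r) (M - 1) = ?l"
      unfolding Q(2) by (rule residue_sum_reduced_numer[OF k N r(1,3)])
    \<comment> \<open>Positivity makes the coefficient of degree \<open>M - 1\<close> nonzero, hence
      the leading one.\<close>
    have "?l > 0" by (rule leading_coeff_pos[OF k N(1) r(2)])
    then have "coeff (Q r) (M - 1) \<noteq> 0" unfolding l by (rule less_imp_neq[symmetric])
    then have deg: "degree (Q r) = M - 1" using Q(1)[of r] le_degree by (metis le_antisym)
    show "degree (Q r) = M - 1 \<and> lead_coeff (Q r) = ?l" unfolding deg using l by blast
  qed
qed

text \<open>There are finitely many residue classes, and each has a polynomial with positive leading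
  coefficient.\<close>

lemma eventually_c_pos:
  assumes k: "k \<ge> 1" and N: "N \<ge> 1" "N \<le> M" and "M \<ge> 2" "\<not> (M = N \<and> k = 1)"
  shows "\<forall>\<^sub>F n in sequentially. c k N M n > 0"
proof -
  let ?L = "Lam k N M"
  obtain Q :: "nat \<Rightarrow> rat poly" where Q:
    "\<And>n. int n > Delta k N M \<Longrightarrow> c k N M n = poly (Q (n mod ?L)) (of_nat n)"
    "\<And>r. r < ?L \<Longrightarrow> lead_coeff (Q r) > 0"
    using G_quasi_polynomial[OF k N] leading_coeff_pos[OF k N(1) assms(5)] assms(4,5) by metis
  have "\<forall>\<^sub>F n in sequentially. \<forall>r\<in>{..<?L}. poly (Q r) (of_nat n) > 0"
    using Q(2) by (intro eventually_ball_finite) (auto intro: rat_poly_eventually_pos)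
  moreover have "\<forall>\<^sub>F n in sequentially. int n > Delta k N M"
    by (rule eventually_mono[OF eventually_gt_at_top[of "nat (Delta k N M)"]]) linarith
  ultimately show ?thesis
    by eventually_elim (use Q(1) Lam_pos[OF k] in auto)
qed

subsection \<open>The case \<open>k = 1\<close>, \<open>M = N\<close>\<close>

text \<open>Constant term 1 is preserved by products and later supplies strict positivity.\<close>

definition nonneg_even :: "rat fps \<Rightarrow> bool" where
  "nonneg_even f \<longleftrightarrow> fps_nth f 0 = 1 \<and> (\<forall>n. fps_nth f n \<ge> 0) \<and> (\<forall>n. odd n \<longrightarrow> fps_nth f n = 0)"

lemma nonneg_even_mult:
  assumes "nonneg_even f" "nonneg_even g"
  shows "nonneg_even (f * g)"
  unfolding nonneg_even_def
proof (intro conjI allI impI)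
  fix n :: nat
  show "fps_nth (f * g) n \<ge> 0"
    using assms by (auto simp: nonneg_even_def fps_mult_nth intro!: sum_nonneg)
  assume n: "odd n"
  have "fps_nth f i * fps_nth g (n - i) = 0" if "i \<le> n" for i
    using assms n that by (cases "even i") (auto simp: nonneg_even_def)
  then show "fps_nth (f * g) n = 0" unfolding fps_mult_nth by (intro sum.neutral) auto
qed (use assms in \<open>simp add: nonneg_even_def\<close>)

lemma nonneg_even_prod:
  assumes "\<And>i. i \<in> A \<Longrightarrow> nonneg_even (f i)"
  shows "nonneg_even (\<Prod>i\<in>A. f i)"
  using assms
proof (induction A rule: infinite_finite_induct)
  case (insert x F)
  then show ?case by (simp add: nonneg_even_mult)
qed (simp_all add: nonneg_even_def)

lemma nonneg_even_inverse_power_series: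
  assumes "even m"
  shows "nonneg_even (inverse_power_series m 1)"
  using assms by (auto simp: nonneg_even_def inverse_power_series_def dest: dvd_trans)

text \<open>The denominator factors pair up as \<open>(1 + x^m) * (1 - x^m) = 1 - x^(2 * m)\<close>
  with \<open>m = 2 * j + 1\<close>. The pair for \<open>j = 0\<close> is split off and gives
  \<open>1 / (1 - x^2)\<close>.\<close>

lemma G_1_diagonal:
  assumes "N \<ge> 1"
  obtains F where "nonneg_even F" "G 1 N N = F * inverse_power_series 2 1"
proof
  let ?P = "\<Prod>r=1..N + N - 1. 1 + fps_X ^ (2 * r) :: rat fps"
  let ?I = "\<lambda>j. inverse_power_series (2 * (2 * j + 1)) 1 :: rat fps"
  have "(\<Prod>i=1..N. 1 + fps_X ^ (2 * i - 1)) = (\<Prod>j<N. 1 + fps_X ^ (2 * j + 1) :: rat fps)"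
    by (simp add: prod.atLeast1_atMost_eq)
  then have "(\<Prod>i=1..N. 1 + fps_X ^ (2 * i - 1)) * (\<Prod>j<N. 1 - fps_X ^ (2 * j + 1))
      = (\<Prod>j<N. 1 - fps_X ^ (2 * (2 * j + 1)) :: rat fps)" (is "?D = ?E")
    by (simp only: prod.distrib[symmetric] mult.commute[of 2 "2 * _ + 1"] power_mult)
      (simp add: algebra_simps power2_eq_square)
  moreover have "(\<Prod>j<N. ?I j) * ?E = 1"
  proof -
    have "?I j * (1 - fps_X ^ (2 * (2 * j + 1))) = 1" for j
    proof -
      have "2 * (2 * j + 1) > 0" by simp
      from inverse_power_series_mult[OF this, of 1] show ?thesis unfolding power_one_right .
    qed
    then show ?thesis unfolding prod.distrib[symmetric] by (intro prod.neutral) blast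
  qed
  ultimately have ID: "(\<Prod>j<N. ?I j) * ?D = 1" by simp
  then have "?D \<noteq> 0" by (metis mult_zero_right zero_neq_one)
  have "?P = ?P * (\<Prod>j<N. ?I j) * ?D" using ID by (simp only: mult.assoc mult_1_right)
  then have "?P / ?D = ?P * (\<Prod>j<N. ?I j)"
    using nonzero_mult_div_cancel_right[OF \<open>?D \<noteq> 0\<close>] by metis
  moreover have "G 1 N N = ?P / ?D" unfolding G_expanded by (simp add: numeral_2_eq_2)
  moreover have "(\<Prod>j<N. ?I j) = (\<Prod>j\<in>{1..<N}. ?I j) * inverse_power_series 2 1"
  proof -
    have "{..<N} = insert 0 {1..<N}" using assms by auto
    moreover have "(\<Prod>j\<in>insert 0 {1..<N}. ?I j) = ?I 0 * (\<Prod>j\<in>{1..<N}. ?I j)"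
      by (rule prod.insert) auto
    moreover have "2 * (2 * 0 + 1) = (2 :: nat)" by simp
    ultimately show ?thesis by (simp only: mult.commute)
  qed
  ultimately show "G 1 N N = ?P * (\<Prod>j\<in>{1..<N}. ?I j) * inverse_power_series 2 1"
    by (simp only: mult.assoc)
  have "nonneg_even (1 + fps_X ^ (2 * r))" if "r \<ge> 1" for r
    using that by (auto simp: nonneg_even_def)
  then show "nonneg_even (?P * (\<Prod>j\<in>{1..<N}. ?I j))"
    by (intro nonneg_even_mult nonneg_even_prod nonneg_even_inverse_power_series) auto
qed

lemma c_1_diagonal:
  assumes "N \<ge> 1"
  shows "odd n \<Longrightarrow> c 1 N N n = 0" and "even n \<Longrightarrow> c 1 N N n > 0"
proof -
  obtain F where F: "nonneg_even F" "G 1 N N = F * inverse_power_series 2 1"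
    using G_1_diagonal[OF assms] .
  show "c 1 N N n = 0" if "odd n"
    using nonneg_even_mult[OF F(1) nonneg_even_inverse_power_series[of 2]] F(2) that
    by (simp add: c_def nonneg_even_def)
  assume "even n"
  let ?I = "inverse_power_series 2 1 :: rat fps"
  \<comment> \<open>The term \<open>i = 0\<close> of the Cauchy product is already 1, and the others
    are nonnegative.\<close>
  have "1 = fps_nth F 0 * fps_nth ?I (n - 0)"
    using F(1) \<open>even n\<close> by (simp add: nonneg_even_def inverse_power_series_def)
  also have "\<dots> \<le> (\<Sum>i=0..n. fps_nth F i * fps_nth ?I (n - i))"
    using F(1) nonneg_even_inverse_power_series[of 2]
    by (intro member_le_sum) (auto simp: nonneg_even_def)
  finally show "c 1 N N n > 0" unfolding c_def F(2) fps_mult_nth by linarith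
qed

text \<open>Eventual positivity is claimed away from \<open>M = N = 1\<close>, where
  \<open>not_eventually_pos_1_1\<close> refutes it.\<close>

theorem theorem1p5:
  fixes k N M :: nat
  assumes "k \<ge> 1" and "N \<ge> 1" and "M \<ge> 1" and "N \<le> M"
  shows "(\<exists>Q :: nat \<Rightarrow> rat poly.
      (\<forall>r < Lam k N M. degree (Q r) \<le> M - 1) \<and>
      (\<forall>r < Lam k N M. \<forall>n. int n > Delta k N M \<and> [n = r] (mod Lam k N M) \<longrightarrow>
          c k N M n = poly (Q r) (of_nat n)) \<and>
      (M > N \<longrightarrow> (\<forall>r < Lam k N M. degree (Q r) = M - 1 \<and>
          lead_coeff (Q r) =
            2 ^ (M - 1) / (fact (M - 1) * (\<Prod>j<M. of_nat ((k + 1) * j + 1))))) \<and>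
      (M = N \<and> N \<ge> 2 \<and> even k \<longrightarrow> (\<forall>r < Lam k N M. degree (Q r) = N - 1 \<and>
          lead_coeff (Q r) =
            2 ^ (N - 1) / (fact (N - 1) * (\<Prod>j<N. of_nat ((k + 1) * j + 1))))) \<and>
      (M = N \<and> N \<ge> 2 \<and> k > 1 \<and> odd k \<longrightarrow> (\<forall>r < Lam k N M. degree (Q r) = N - 1 \<and>
          lead_coeff (Q r) =
            1 / fact (N - 1) *
              (2 ^ (N - 1) / (\<Prod>j<N. of_nat ((k + 1) * j + 1)) +
               (- 1) ^ r * (2 ^ (N - 1) / (\<Prod>i=1..N. of_nat ((k + 1) * i - 1)))) \<and>
          lead_coeff (Q r) > 0)))
    \<and> (\<not> (M = N \<and> (k = 1 \<or> N = 1)) \<longrightarrow> (\<forall>\<^sub>F n in sequentially. c k N M n > 0))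
    \<and> (M = N \<and> k = 1 \<longrightarrow> (\<forall>n. (odd n \<longrightarrow> c k N M n = 0) \<and> (even n \<longrightarrow> c k N M n > 0)))"
proof -
  let ?L = "Lam k N M"
  obtain Q :: "nat \<Rightarrow> rat poly" where Q:
    "\<And>r. degree (Q r) \<le> M - 1"
    "\<And>n. int n > Delta k N M \<Longrightarrow> c k N M n = poly (Q (n mod ?L)) (of_nat n)"
    "\<And>r. M \<ge> 2 \<Longrightarrow> \<not> (M = N \<and> k = 1) \<Longrightarrow> r < ?L \<Longrightarrow>
      degree (Q r) = M - 1 \<and> lead_coeff (Q r) = 1 / fact (M - 1) *
        (2 ^ (M - 1) / (\<Prod>j<M. of_nat ((k + 1) * j + 1)) +
        (if M = N \<and> odd k then (- 1) ^ r * (2 ^ (N - 1) / (\<Prod>i=1..N. of_nat ((k + 1) * i - 1))) else 0))"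
    using G_quasi_polynomial[OF assms(1,2,4)] by blast
  have pos: "lead_coeff (Q r) > 0" if "M \<ge> 2" "\<not> (M = N \<and> k = 1)" "r < ?L" for r
    unfolding Q(3)[OF that, THEN conjunct2] by (rule leading_coeff_pos[OF assms(1,2) that(2)])
  show ?thesis
  proof (intro conjI exI[of _ Q])
    show "\<forall>r<?L. degree (Q r) \<le> M - 1" using Q(1) by blast
    show "\<forall>r<?L. \<forall>n. int n > Delta k N M \<and> [n = r] (mod ?L) \<longrightarrow> c k N M n = poly (Q r) (of_nat n)"
      using Q(2) by (auto simp: cong_def)
    show "M > N \<longrightarrow> (\<forall>r<?L. degree (Q r) = M - 1 \<and> lead_coeff (Q r) =
        2 ^ (M - 1) / (fact (M - 1) * (\<Prod>j<M. of_nat ((k + 1) * j + 1))))"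
    proof (intro impI allI)
      fix r assume "M > N" "r < ?L"
      then show "degree (Q r) = M - 1 \<and> lead_coeff (Q r) =
        2 ^ (M - 1) / (fact (M - 1) * (\<Prod>j<M. of_nat ((k + 1) * j + 1)))"
        using Q(3)[of r] assms(2) by auto
    qed
    show "M = N \<and> N \<ge> 2 \<and> even k \<longrightarrow> (\<forall>r<?L. degree (Q r) = N - 1 \<and> lead_coeff (Q r) =
        2 ^ (N - 1) / (fact (N - 1) * (\<Prod>j<N. of_nat ((k + 1) * j + 1))))"
    proof (intro impI allI)
      fix r assume *: "M = N \<and> N \<ge> 2 \<and> even k" "r < ?L"
      moreover from this have "k \<noteq> 1" by auto
      ultimately show "degree (Q r) = N - 1 \<and> lead_coeff (Q r) =
        2 ^ (N - 1) / (fact (N - 1) * (\<Prod>j<N. of_nat ((k + 1) * j + 1)))"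
        using Q(3)[of r] * by auto
    qed
    show "M = N \<and> N \<ge> 2 \<and> k > 1 \<and> odd k \<longrightarrow> (\<forall>r<?L. degree (Q r) = N - 1 \<and> lead_coeff (Q r) =
        1 / fact (N - 1) * (2 ^ (N - 1) / (\<Prod>j<N. of_nat ((k + 1) * j + 1)) +
          (- 1) ^ r * (2 ^ (N - 1) / (\<Prod>i=1..N. of_nat ((k + 1) * i - 1)))) \<and> lead_coeff (Q r) > 0)"
    proof (intro impI allI)
      fix r assume *: "M = N \<and> N \<ge> 2 \<and> k > 1 \<and> odd k" "r < ?L"
      then have "lead_coeff (Q r) > 0" by (intro pos) auto
      moreover have "degree (Q r) = N - 1 \<and> lead_coeff (Q r) =
        1 / fact (N - 1) * (2 ^ (N - 1) / (\<Prod>j<N. of_nat ((k + 1) * j + 1)) +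
          (- 1) ^ r * (2 ^ (N - 1) / (\<Prod>i=1..N. of_nat ((k + 1) * i - 1))))"
        using Q(3)[of r] * by auto
      ultimately show "degree (Q r) = N - 1 \<and> lead_coeff (Q r) =
        1 / fact (N - 1) * (2 ^ (N - 1) / (\<Prod>j<N. of_nat ((k + 1) * j + 1)) +
          (- 1) ^ r * (2 ^ (N - 1) / (\<Prod>i=1..N. of_nat ((k + 1) * i - 1)))) \<and> lead_coeff (Q r) > 0"
        by blast
    qed
    \<comment> \<open>\<open>M = 1\<close> would force \<open>N = 1\<close>, which is excluded, so
      \<open>M \<ge> 2\<close> holds.\<close>
    show "\<not> (M = N \<and> (k = 1 \<or> N = 1)) \<longrightarrow> (\<forall>\<^sub>F n in sequentially. c k N M n > 0)"
      using eventually_c_pos[OF assms(1,2,4)] assms(2,4) by (cases "M = 1") auto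
    show "M = N \<and> k = 1 \<longrightarrow> (\<forall>n. (odd n \<longrightarrow> c k N M n = 0) \<and> (even n \<longrightarrow> c k N M n > 0))"
      using c_1_diagonal[OF assms(2)] by blast
  qed
qed

end
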